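(* Let $G$ be a strongly uncontrollable graph with vertex set $V=\{v_1,v_2,\ldots,v_n\}$ and Laplacian matrix $L$. Let $G_2=(\{v_{n+1},v_{n+2}\},\emptyset)$ be the empty graph on two vertices and let $\widetilde{G}=G\vee G_2$. Then $\widetilde{G}$ is a strongly uncontrollable graph if and only if $n-2$ and $n$ are not eigenvalues of $L$ (i.e., neither is an eigenvalue). In this case, $\mathrm{Aut}(\widetilde{G})$ is generated by the union of a generating set of $\mathrm{Aut}(G)$ and the transposition $\tau=(n+1\;\;n+2)$.
   Context: Graphs are finite, simple and undirected. The join $G_1\vee G_2$ of graphs on disjoint vertex sets $V_1,V_2$ has vertex set $V_1\cup V_2$ and edge set $E_1\cup E_2\cup\{\{u,v\}: u\in V_1, v\in V_2\}$. The Laplacian matrix of a graph is $L=D-A$, where $A$ is the adjacency matrix and $D$ the diagonal degree matrix. A matrix has simple spectrum if every eigenvalue has algebraic multiplicity one. For $L\in\mathbb{R}^{n\times n}$ and $b\in\mathbb{R}^n$, $(L,b)$ is controllable if $\mathrm{span}\{b,Lb,\ldots,L^{n-1}b\}=\mathbb{R}^n$, and uncontrollable otherwise. A simple connected graph $G$ on $n$ vertices is strongly uncontrollable if its Laplacian $L$ has simple spectrum and $(L,b)$ is uncontrollable for every $b\in\{0,1\}^n$. $\mathrm{Aut}(\cdot)$ is the group of graph automorphisms, viewed as permutations of indices; automorphisms of $G$ are viewed as permutations of $\{1,\ldots,n+2\}$ fixing $n+1$ and $n+2$. *)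

theory Defs
  imports
    Complex_Main
    "HOL-Combinatorics.Permutations"
    "HOL-Algebra.Generated_Groups"
    "Graph_Theory.Graph_Theory"
    "Jordan_Normal_Form.Char_Poly"
    "Jordan_Normal_Form.VS_Connect"
begin

text \<open>Finite simple undirected graphs are the \<open>pair_graph\<close>s of the library: finite, loop-free
  digraphs with a symmetric arc relation, where the edge \<open>{u,v}\<close> is represented by the two arcs
  \<open>(u,v)\<close> and \<open>(v,u)\<close>.\<close>

definition graph_join :: "'a pair_pre_digraph \<Rightarrow> 'a pair_pre_digraph \<Rightarrow> 'a pair_pre_digraph" where
  "graph_join G H = \<lparr> pverts = pverts G \<union> pverts H,
     parcs = parcs G \<union> parcs H \<union> pverts G \<times> pverts H \<union> pverts H \<times> pverts G \<rparr>"

definition empty_graph :: "'a set \<Rightarrow> 'a pair_pre_digraph" where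
  "empty_graph V = \<lparr> pverts = V, parcs = {} \<rparr>"

text \<open>The matrices below are those of a graph with vertex set \<open>{1..n}\<close>. Matrix indices start
  at 0, so row and column \<open>i\<close> belong to vertex \<open>i + 1\<close>.\<close>

definition adjacency_mat :: "nat \<Rightarrow> nat pair_pre_digraph \<Rightarrow> real mat" where
  "adjacency_mat n G = mat n n (\<lambda>(i, j). if (i + 1, j + 1) \<in> parcs G then 1 else 0)"

definition degree_mat :: "nat \<Rightarrow> nat pair_pre_digraph \<Rightarrow> real mat" where
  "degree_mat n G =
     mat n n (\<lambda>(i, j). if i = j then real (card {v \<in> pverts G. (i + 1, v) \<in> parcs G}) else 0)"

definition laplacian_mat :: "nat \<Rightarrow> nat pair_pre_digraph \<Rightarrow> real mat" where
  "laplacian_mat n G = degree_mat n G - adjacency_mat n G"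

text \<open>All complex eigenvalues of the real matrix are taken into account, with their
  multiplicity as roots of the characteristic polynomial.\<close>

definition simple_spectrum :: "real mat \<Rightarrow> bool" where
  "simple_spectrum A \<longleftrightarrow>
     (\<forall>k. eigenvalue (map_mat complex_of_real A) k \<longrightarrow>
        order k (char_poly (map_mat complex_of_real A)) = 1)"

definition controllable :: "nat \<Rightarrow> real mat \<Rightarrow> real vec \<Rightarrow> bool" where
  "controllable n L b \<longleftrightarrow>
     LinearCombinations.module.span class_ring (module_vec TYPE(real) n)
       ((\<lambda>k. (L ^\<^sub>m k) *\<^sub>v b) ` {..<n}) = carrier_vec n"

definition strongly_uncontrollable :: "nat \<Rightarrow> nat pair_pre_digraph \<Rightarrow> bool" where
  "strongly_uncontrollable n G \<longleftrightarrow>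
     pair_graph G \<and> pverts G = {1..n} \<and> connected (with_proj G) \<and>
     simple_spectrum (laplacian_mat n G) \<and>
     (\<forall>b \<in> carrier_vec n. (\<forall>i<n. b $ i \<in> {0, 1}) \<longrightarrow> \<not> controllable n (laplacian_mat n G) b)"

text \<open>\<open>p permutes V\<close> makes an automorphism a permutation of the whole vertex type that fixes
  everything outside \<open>V\<close>. An automorphism of \<open>G\<close> is thereby also a permutation of the
  vertices of any graph containing those of \<open>G\<close>, fixing the additional vertices.\<close>

definition aut_group :: "'a pair_pre_digraph \<Rightarrow> ('a \<Rightarrow> 'a) monoid" where
  "aut_group G =
     \<lparr> carrier = {p. p permutes pverts G \<and>
         (\<forall>u \<in> pverts G. \<forall>v \<in> pverts G. (p u, p v) \<in> parcs G \<longleftrightarrow> (u, v) \<in> parcs G)},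
       monoid.mult = (\<circ>), one = id \<rparr>"

definition generating_set :: "('a, 'b) monoid_scheme \<Rightarrow> 'a set \<Rightarrow> bool" where
  "generating_set G S \<longleftrightarrow> S \<subseteq> carrier G \<and> generate G S = carrier G"

end

theory Submission
  imports Defs
begin

text \<open>
  The Laplacian of the join has the following orthogonal eigenvectors: the eigenvectors of \<open>L\<close>
  orthogonal to the all-ones vector, padded with two zeros, their eigenvalues raised by 2; the
  difference of the indicators of the two new vertices, with eigenvalue \<open>n\<close>; the all-ones vector,
  with eigenvalue \<open>0\<close>; and the vector with entries \<open>2\<close> on the old and \<open>-n\<close> on the new vertices,
  with eigenvalue \<open>n + 2\<close>. As the eigenvalues of \<open>L\<close> are distinct and nonnegative, the only
  possible coincidences are with \<open>n\<close> and \<open>n + 2\<close>, and they occur exactly if \<open>n - 2\<close> or \<open>n\<close> is an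
  eigenvalue of \<open>L\<close> (\<open>join_two_simple_spectrum_iff\<close>).

  Uncontrollability carries over without any condition. For a symmetric matrix with simple spectrum,
  \<open>b\<close> fails to control exactly if it is orthogonal to an eigenvector
  (\<open>not_controllable_if_orthogonal\<close>, \<open>not_controllable_imp_orthogonal\<close>). The restriction of a 0/1
  vector to the old vertices is orthogonal to an eigenvector of \<open>L\<close>, which can be chosen with a
  nonzero eigenvalue, and its padding is an eigenvector of the join orthogonal to the given vector
  (\<open>join_two_not_controllable\<close>).

  For the automorphisms, the two new vertices are non-adjacent and joined to everything else. Two
  old vertices with this property inside \<open>G\<close> would make \<open>n - 2\<close> an eigenvalue of \<open>L\<close>. Hence every
  automorphism of the join preserves the set of new vertices (\<open>join_two_aut_new_vertices\<close>), so it is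
  an automorphism of \<open>G\<close>, possibly followed by the transposition.
\<close>

section \<open>Real symmetric matrices with simple spectrum\<close>

lemma scalar_prod_self_eq_0:
  fixes x :: "real vec"
  assumes "x \<in> carrier_vec n"
  shows "x \<bullet> x = 0 \<longleftrightarrow> x = 0\<^sub>v n"
proof
  assume "x \<bullet> x = 0"
  then have "\<forall>i<n. x $ i * x $ i = 0"
    using assms by (subst (asm) scalar_prod_def, subst (asm) sum_nonneg_eq_0_iff) auto
  then show "x = 0\<^sub>v n" using assms by (intro eq_vecI) auto
qed (use assms in auto)

text \<open>For the matrix \<open>P\<close> with rows \<open>f i\<close>, the product of \<open>P\<close> and its transpose is diagonal with the
  nonzero entries \<open>f i \<bullet> f i\<close>, so \<open>P\<close> is regular, while \<open>P x = 0\<close>. It serves in place of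
  a dimension count.\<close>

lemma orthogonal_family_complete:
  fixes f :: "nat \<Rightarrow> real vec"
  assumes f: "\<And>i. i < n \<Longrightarrow> f i \<in> carrier_vec n"
    and nz: "\<And>i. i < n \<Longrightarrow> f i \<noteq> 0\<^sub>v n"
    and orth: "\<And>i j. i < n \<Longrightarrow> j < n \<Longrightarrow> i \<noteq> j \<Longrightarrow> f i \<bullet> f j = 0"
    and x: "x \<in> carrier_vec n" and fx: "\<And>i. i < n \<Longrightarrow> f i \<bullet> x = 0"
  shows "x = 0\<^sub>v n"
proof (rule ccontr)
  assume x0: "x \<noteq> 0\<^sub>v n"
  define P where "P = mat n n (\<lambda>(i, j). f i $ j)"
  have P: "P \<in> carrier_mat n n" by (simp add: P_def)
  have row: "row P i = f i" if "i < n" for i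
    using f[OF that] that by (intro eq_vecI) (auto simp: P_def)
  have "P *\<^sub>v x = 0\<^sub>v n" using P by (intro eq_vecI) (auto simp: row fx)
  with x x0 have "det P = 0" unfolding det_0_iff_vec_prod_zero[OF P] by blast
  then have 0: "det (P * transpose_mat P) = 0" using P by (simp add: det_mult[of _ n])
  have PPT: "(P * transpose_mat P) $$ (i, j) = f i \<bullet> f j" if "i < n" "j < n" for i j
    using that P by (simp add: row)
  have "det (P * transpose_mat P) = prod_list (diag_mat (P * transpose_mat P))"
    by (rule det_upper_triangular[of _ n]) (use P in \<open>auto simp: row orth\<close>)
  also have "\<dots> \<noteq> 0"
    using P nz by (auto simp: prod_list_zero_iff diag_mat_def row scalar_prod_self_eq_0[OF f])
  finally show False using 0 by simp
qed

lemma symmetric_mat_self_adjoint: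
  fixes A :: "real mat"
  assumes "A \<in> carrier_mat n n" "transpose_mat A = A" "x \<in> carrier_vec n" "y \<in> carrier_vec n"
  shows "(A *\<^sub>v x) \<bullet> y = x \<bullet> (A *\<^sub>v y)"
  using transpose_vec_mult_scalar[of A n n y x] assms by simp

lemma symmetric_eigenvectors_orthogonal:
  fixes A :: "real mat"
  assumes A: "A \<in> carrier_mat n n" "transpose_mat A = A"
    and x: "eigenvector A x k" and y: "eigenvector A y l" and "k \<noteq> l"
  shows "x \<bullet> y = 0"
proof -
  have c: "x \<in> carrier_vec n" "y \<in> carrier_vec n" "A *\<^sub>v x = k \<cdot>\<^sub>v x" "A *\<^sub>v y = l \<cdot>\<^sub>v y"
    using x y A by (auto simp: eigenvector_def)
  have "k * (x \<bullet> y) = l * (x \<bullet> y)"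
    using symmetric_mat_self_adjoint[OF A c(1,2)] c by simp
  then show ?thesis using \<open>k \<noteq> l\<close> by simp
qed

text \<open>Writing an eigenvector as \<open>x + i y\<close>, the real identity \<open>A x \<bullet> y = x \<bullet> A y\<close> reduces to
  \<open>Im z * (x \<bullet> x + y \<bullet> y) = 0\<close>.\<close>

lemma symmetric_complex_eigenvalue_real:
  fixes A :: "real mat"
  assumes A: "A \<in> carrier_mat n n" "transpose_mat A = A"
    and ev: "eigenvalue (map_mat complex_of_real A) z"
  shows "Im z = 0"
proof -
  obtain v where v: "v \<in> carrier_vec n" "v \<noteq> 0\<^sub>v n"
    and Av: "map_mat complex_of_real A *\<^sub>v v = z \<cdot>\<^sub>v v"
    using ev A by (auto simp: eigenvalue_def eigenvector_def)
  define x where "x = map_vec Re v"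
  define y where "y = map_vec Im v"
  have c: "x \<in> carrier_vec n" "y \<in> carrier_vec n" using v by (auto simp: x_def y_def)
  have entry: "(\<Sum>j<n. complex_of_real (A $$ (i, j)) * v $ j) = z * v $ i" if "i < n" for i
    using arg_cong[OF Av, of "\<lambda>w. w $ i"] that A(1) v(1)
    by (simp add: scalar_prod_def atLeast0LessThan)
  have Ax: "A *\<^sub>v x = Re z \<cdot>\<^sub>v x - Im z \<cdot>\<^sub>v y"
  proof (rule eq_vecI)
    fix i assume "i < dim_vec (Re z \<cdot>\<^sub>v x - Im z \<cdot>\<^sub>v y)"
    then have i: "i < n" using c by simp
    show "(A *\<^sub>v x) $ i = (Re z \<cdot>\<^sub>v x - Im z \<cdot>\<^sub>v y) $ i"
      using arg_cong[OF entry[OF i], of Re] i A(1) v(1)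
      by (simp add: scalar_prod_def atLeast0LessThan x_def y_def)
  qed (use A c in auto)
  have Ay: "A *\<^sub>v y = Re z \<cdot>\<^sub>v y + Im z \<cdot>\<^sub>v x"
  proof (rule eq_vecI)
    fix i assume "i < dim_vec (Re z \<cdot>\<^sub>v y + Im z \<cdot>\<^sub>v x)"
    then have i: "i < n" using c by simp
    show "(A *\<^sub>v y) $ i = (Re z \<cdot>\<^sub>v y + Im z \<cdot>\<^sub>v x) $ i"
      using arg_cong[OF entry[OF i], of Im] i A(1) v(1)
      by (simp add: scalar_prod_def atLeast0LessThan x_def y_def)
  qed (use A c in auto)
  have "(A *\<^sub>v x) \<bullet> y = x \<bullet> (A *\<^sub>v y)" by (rule symmetric_mat_self_adjoint[OF A c])
  then have eq: "Im z * (x \<bullet> x + y \<bullet> y) = 0"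
    using c unfolding Ax Ay
    by (simp add: minus_scalar_prod_distrib[of _ n] scalar_prod_add_distrib[of _ n] algebra_simps)
  have nn: "x \<bullet> x \<ge> 0" "y \<bullet> y \<ge> 0" by (auto simp: scalar_prod_def intro!: sum_nonneg)
  show ?thesis
  proof (rule ccontr)
    assume "Im z \<noteq> 0"
    then have xy0: "x = 0\<^sub>v n" "y = 0\<^sub>v n"
      using eq nn c scalar_prod_self_eq_0 by (auto simp: add_nonneg_eq_0_iff)
    have "v $ i = 0" if "i < n" for i
      using that v(1) arg_cong[OF xy0(1), of "\<lambda>w. w $ i"] arg_cong[OF xy0(2), of "\<lambda>w. w $ i"]
      by (simp add: x_def y_def complex_eq_iff)
    with v show False by (auto intro: eq_vecI)
  qed
qed

text \<open>Since the complex eigenvalues are all real, a simple spectrum amounts to a number of real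
  eigenvalues equal to the degree of the characteristic polynomial. In this form it can be proved
  by exhibiting eigenvalues, without computing any characteristic polynomial.\<close>

lemma simple_spectrum_iff_card:
  fixes A :: "real mat"
  assumes A: "A \<in> carrier_mat n n" "transpose_mat A = A"
  shows "simple_spectrum A \<longleftrightarrow> card {k. eigenvalue A k} = n"
proof -
  let ?B = "map_mat complex_of_real A"
  let ?p = "char_poly ?B"
  have B: "?B \<in> carrier_mat n n" using A by simp
  have deg: "degree ?p = n" and p0: "?p \<noteq> 0" using degree_monic_char_poly[OF B] by auto
  have root: "eigenvalue ?B z \<longleftrightarrow> poly ?p z = 0" for z
    by (rule eigenvalue_root_char_poly[OF B])
  have of_real: "eigenvalue ?B (of_real k) \<longleftrightarrow> eigenvalue A k" for k
    unfolding root eigenvalue_root_char_poly[OF A(1)] of_real_hom.char_poly_hom[OF A(1)] by simp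
  have "{z. poly ?p z = 0} = of_real ` {k. eigenvalue A k}"
  proof (intro equalityI subsetI)
    fix z assume "z \<in> {z. poly ?p z = 0}"
    then have z: "eigenvalue ?B z" by (simp add: root)
    then have "z = of_real (Re z)"
      using symmetric_complex_eigenvalue_real[OF A] by (simp add: complex_eq_iff)
    with z of_real show "z \<in> of_real ` {k. eigenvalue A k}" by (metis imageI mem_Collect_eq)
  qed (use of_real root in auto)
  then have card: "card {z. poly ?p z = 0} = card {k. eigenvalue A k}"
    by (simp add: card_image inj_on_def)
  have "simple_spectrum A \<longleftrightarrow> rsquarefree ?p"
    unfolding simple_spectrum_def root rsquarefree_def using p0 by (metis order_root)
  then show ?thesis using rsquarefree_card_degree[OF p0] card deg by simp
qed

lemma finite_card_eigenvalues:
  fixes A :: "real mat"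
  assumes "A \<in> carrier_mat n n"
  shows "finite {k. eigenvalue A k}" "card {k. eigenvalue A k} \<le> n"
proof -
  have "char_poly A \<noteq> 0" "degree (char_poly A) = n" using degree_monic_char_poly[OF assms] by auto
  then show "finite {k. eigenvalue A k}" "card {k. eigenvalue A k} \<le> n"
    using poly_roots_finite[of "char_poly A"] poly_roots_degree[of "char_poly A"]
    by (simp_all add: eigenvalue_root_char_poly[OF assms])
qed

lemma simple_spectrum_eigenbasis:
  fixes A :: "real mat"
  assumes A: "A \<in> carrier_mat n n" "transpose_mat A = A" and simple: "simple_spectrum A"
  obtains l v where "bij_betw l {..<n} {k. eigenvalue A k}"
    "\<And>i. i < n \<Longrightarrow> eigenvector A (v i) (l i)"
    "\<And>i j. i < n \<Longrightarrow> j < n \<Longrightarrow> i \<noteq> j \<Longrightarrow> v i \<bullet> v j = 0"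
proof -
  have "card {k. eigenvalue A k} = n" using simple simple_spectrum_iff_card[OF A] by simp
  then obtain l where l: "bij_betw l {..<n} {k. eigenvalue A k}"
    using ex_bij_betw_nat_finite[OF finite_card_eigenvalues(1)[OF A(1)]]
    by (metis atLeast0LessThan)
  then have "\<forall>i\<in>{..<n}. \<exists>v. eigenvector A v (l i)"
    by (force dest: bij_betwE simp: eigenvalue_def)
  then obtain v where v: "\<forall>i\<in>{..<n}. eigenvector A (v i) (l i)" by metis
  have "v i \<bullet> v j = 0" if "i < n" "j < n" "i \<noteq> j" for i j
    using symmetric_eigenvectors_orthogonal[OF A] v that bij_betw_imp_inj_on[OF l]
    by (metis inj_onD lessThan_iff)
  with l v show ?thesis by (intro that) auto
qed

text \<open>Eigenspaces are one-dimensional, in the form that is applied. In an eigenbasis, \<open>x\<close> can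
  replace the basis vector for \<open>k\<close>; then \<open>y\<close> is orthogonal to a complete orthogonal family.\<close>

lemma simple_spectrum_no_orthogonal_eigenvectors:
  fixes A :: "real mat"
  assumes A: "A \<in> carrier_mat n n" "transpose_mat A = A" and simple: "simple_spectrum A"
    and x: "eigenvector A x k" and y: "eigenvector A y k"
  shows "x \<bullet> y \<noteq> 0"
proof
  assume xy: "x \<bullet> y = 0"
  obtain l v where l: "bij_betw l {..<n} {k. eigenvalue A k}"
    and v: "\<And>i. i < n \<Longrightarrow> eigenvector A (v i) (l i)"
    and orth: "\<And>i j. i < n \<Longrightarrow> j < n \<Longrightarrow> i \<noteq> j \<Longrightarrow> v i \<bullet> v j = 0"
    by (rule simple_spectrum_eigenbasis[OF A simple]) blast
  have "k \<in> {k. eigenvalue A k}" using x by (auto simp: eigenvalue_def)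
  then obtain m where m: "m < n" "l m = k"
    using l by (metis bij_betw_imp_surj_on imageE lessThan_iff)
  have ne: "l i \<noteq> k" if "i < n" "i \<noteq> m" for i
    using that m bij_betw_imp_inj_on[OF l] by (metis inj_onD lessThan_iff)
  define f where "f = v(m := x)"
  have ev: "eigenvector A (f i) (l i)" if "i < n" for i using v that x m by (simp add: f_def)
  have "y = 0\<^sub>v n"
  proof (rule orthogonal_family_complete[of n f])
    fix i j assume ij: "i < n" "j < n" "i \<noteq> j"
    then have "l i \<noteq> l j" using bij_betw_imp_inj_on[OF l] by (metis inj_onD lessThan_iff)
    then show "f i \<bullet> f j = 0"
      using symmetric_eigenvectors_orthogonal[OF A ev ev] ij by blast
  next
    fix i assume i: "i < n"
    show "f i \<bullet> y = 0"
    proof (cases "i = m")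
      case False
      then show ?thesis using symmetric_eigenvectors_orthogonal[OF A ev[OF i] y ne] i by blast
    qed (simp add: f_def xy)
  qed (use ev y A in \<open>auto simp: eigenvector_def\<close>)
  with y A show False by (simp add: eigenvector_def)
qed

section \<open>Eigenvectors and controllability\<close>

lemma pow_mat_Suc_mult_vec:
  fixes A :: "real mat"
  assumes A: "A \<in> carrier_mat n n" and b: "b \<in> carrier_vec n"
  shows "(A ^\<^sub>m Suc k) *\<^sub>v b = A *\<^sub>v ((A ^\<^sub>m k) *\<^sub>v b)"
proof -
  have "A ^\<^sub>m Suc k = A * A ^\<^sub>m k"
    using A by (induction k) (auto simp: assoc_mult_mat[of _ n n _ n _ n] pow_carrier_mat)
  then show ?thesis by (simp only: assoc_mult_mat_vec[OF A pow_carrier_mat[OF A] b])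
qed

text \<open>Every vector \<open>A^m b\<close> is orthogonal to \<open>v\<close>, because \<open>v \<bullet> A^m b = k^m (v \<bullet> b)\<close>.\<close>

lemma not_controllable_if_orthogonal:
  fixes A :: "real mat"
  assumes A: "A \<in> carrier_mat n n" "transpose_mat A = A" and b: "b \<in> carrier_vec n"
    and v: "eigenvector A v k" and vb: "v \<bullet> b = 0"
  shows "\<not> controllable n A b"
proof
  interpret vec_space "TYPE(real)" n .
  assume c: "controllable n A b"
  have vc: "v \<in> carrier_vec n" "v \<noteq> 0\<^sub>v n" "A *\<^sub>v v = k \<cdot>\<^sub>v v" using v A by (auto simp: eigenvector_def)
  have kr: "(A ^\<^sub>m m) *\<^sub>v b \<in> carrier_vec n" for m
    by (rule mult_mat_vec_carrier[OF pow_carrier_mat[OF A(1)] b])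
  have 0: "v \<bullet> ((A ^\<^sub>m m) *\<^sub>v b) = 0" for m
  proof (induction m)
    case (Suc m)
    have "v \<bullet> ((A ^\<^sub>m Suc m) *\<^sub>v b) = (A *\<^sub>v v) \<bullet> ((A ^\<^sub>m m) *\<^sub>v b)"
      unfolding pow_mat_Suc_mult_vec[OF A(1) b]
      by (rule symmetric_mat_self_adjoint[OF A vc(1) kr, symmetric])
    then show ?case using Suc vc kr[of m] by simp
  qed (use A b vb in auto)
  let ?K = "(\<lambda>k. (A ^\<^sub>m k) *\<^sub>v b) ` {..<n}"
  have "?K \<subseteq> carrier_vec n" using kr by auto
  moreover have "v \<in> orthogonal_complement ?K"
    using vc 0 by (auto simp: orthogonal_complement_def)
  ultimately have "v \<in> orthogonal_complement (carrier_vec n)"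
    using c in_orthogonal_complement_span unfolding controllable_def by metis
  then have "v \<bullet> v = 0" using vc by (auto simp: orthogonal_complement_def)
  with vc show False by (simp add: scalar_prod_self_eq_0)
qed

text \<open>The square matrix with columns \<open>b, A b, \<dots>, A^(n-1) b\<close> is singular, since the columns of a
  regular matrix span the whole space; \<open>w\<close> is a vector in the kernel of its transpose.\<close>

lemma not_controllable_annihilator:
  fixes A :: "real mat"
  assumes A: "A \<in> carrier_mat n n" and b: "b \<in> carrier_vec n"
    and c: "\<not> controllable n A b"
  obtains w where "w \<in> carrier_vec n" "w \<noteq> 0\<^sub>v n" "\<And>k. k < n \<Longrightarrow> w \<bullet> ((A ^\<^sub>m k) *\<^sub>v b) = 0"
proof -
  interpret vec_space "TYPE(real)" n .
  define ws where "ws = map (\<lambda>k. (A ^\<^sub>m k) *\<^sub>v b) [0..<n]"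
  define K where "K = mat_of_cols n ws"
  have ws: "set ws \<subseteq> carrier_vec n"
    using mult_mat_vec_carrier[OF pow_carrier_mat[OF A] b] by (auto simp: ws_def)
  have K: "K \<in> carrier_mat n n" by (auto simp: K_def ws_def)
  have "det K = 0"
  proof (rule ccontr)
    assume d: "det K \<noteq> 0"
    have "x \<in> span (set ws)" if x: "x \<in> carrier_vec n" for x
    proof -
      define y where "y = (1 / det K) \<cdot>\<^sub>v (adj_mat K *\<^sub>v x)"
      have y: "y \<in> carrier_vec n" using adj_mat(1)[OF K] x by (auto simp: y_def)
      have "K *\<^sub>v y = (1 / det K) \<cdot>\<^sub>v ((K * adj_mat K) *\<^sub>v x)"
        using K adj_mat(1)[OF K] x by (simp add: y_def mult_mat_vec[of _ n n])
      also have "(K * adj_mat K) *\<^sub>v x = det K \<cdot>\<^sub>v x"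
        unfolding adj_mat(2)[OF K] using x by (intro eq_vecI) auto
      also have "(1 / det K) \<cdot>\<^sub>v (det K \<cdot>\<^sub>v x) = x" using d by (simp add: smult_smult_assoc)
      finally have Ky: "K *\<^sub>v y = x" .
      have vec_y: "vec n (($) y) = y" using y by (intro eq_vecI) auto
      have "x = mat_of_cols n ws *\<^sub>v vec (length ws) (($) y)"
        using vec_y Ky by (simp add: K_def ws_def)
      also have "\<dots> = lincomb_list (($) y) ws"
        using ws by (intro lincomb_list_as_mat_mult[symmetric]) auto
      finally have "x \<in> span_list ws" by (auto simp: span_list_def)
      then show ?thesis using span_list_as_span[OF ws] by simp
    qed
    then have "span (set ws) = carrier_vec n" using span_closed[of "set ws"] ws by auto
    moreover have "set ws = (\<lambda>k. (A ^\<^sub>m k) *\<^sub>v b) ` {..<n}" by (auto simp: ws_def)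
    ultimately show False using c by (simp add: controllable_def)
  qed
  then have "det (transpose_mat K) = 0" using det_transpose[OF K] by simp
  then obtain w where w: "w \<in> carrier_vec n" "w \<noteq> 0\<^sub>v n" "transpose_mat K *\<^sub>v w = 0\<^sub>v n"
    using det_0_iff_vec_prod_zero[of "transpose_mat K" n] K by auto
  have "w \<bullet> ((A ^\<^sub>m k) *\<^sub>v b) = 0" if "k < n" for k
  proof -
    have "col K k = (A ^\<^sub>m k) *\<^sub>v b"
      using that ws unfolding K_def by (subst col_mat_of_cols) (auto simp: ws_def)
    moreover have "(transpose_mat K *\<^sub>v w) $ k = col K k \<bullet> w" using that K by simp
    moreover have "col K k \<in> carrier_vec n" using K by auto
    ultimately show ?thesis using w that by (simp add: comm_scalar_prod[of _ n])
  qed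
  with w show ?thesis by (intro that)
qed

text \<open>The converse of \<open>not_controllable_if_orthogonal\<close> (together, the Popov-Belevitch-Hautus test). Start from
  a vector \<open>w \<noteq> 0\<close> orthogonal to \<open>b, A b, \<dots>, A^(n-1) b\<close> and apply \<open>A - l 0\<close>, \<open>A - l 1\<close>, \<open>\<dots>\<close> in turn,
  one factor for each eigenvalue. All \<open>n\<close> factors together kill \<open>w\<close>, so some iterate is the last
  nonzero one, and it is an eigenvector. Fewer than \<open>n\<close> factors were applied to reach it, so it is
  still orthogonal to \<open>b\<close>.\<close>

lemma not_controllable_imp_orthogonal:
  fixes A :: "real mat"
  assumes A: "A \<in> carrier_mat n n" "transpose_mat A = A" and simple: "simple_spectrum A"
    and b: "b \<in> carrier_vec n" and c: "\<not> controllable n A b"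
  obtains v k where "eigenvector A v k" "v \<bullet> b = 0"
proof -
  obtain w where w: "w \<in> carrier_vec n" "w \<noteq> 0\<^sub>v n" "\<And>k. k < n \<Longrightarrow> w \<bullet> ((A ^\<^sub>m k) *\<^sub>v b) = 0"
    by (rule not_controllable_annihilator[OF A(1) b c]) blast
  obtain l v where l: "bij_betw l {..<n} {k. eigenvalue A k}"
    and v: "\<And>i. i < n \<Longrightarrow> eigenvector A (v i) (l i)"
    and orth: "\<And>i j. i < n \<Longrightarrow> j < n \<Longrightarrow> i \<noteq> j \<Longrightarrow> v i \<bullet> v j = 0"
    by (rule simple_spectrum_eigenbasis[OF A simple]) blast
  have vc: "v i \<in> carrier_vec n" "v i \<noteq> 0\<^sub>v n" "A *\<^sub>v v i = l i \<cdot>\<^sub>v v i" if "i < n" for i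
    using v[OF that] A by (auto simp: eigenvector_def)
  define u where "u = rec_nat w (\<lambda>k x. A *\<^sub>v x - l k \<cdot>\<^sub>v x)"
  have u0: "u 0 = w" and uS: "u (Suc k) = A *\<^sub>v u k - l k \<cdot>\<^sub>v u k" for k by (simp_all add: u_def)
  have uc: "u k \<in> carrier_vec n" for k by (induction k) (use w A in \<open>auto simp: u0 uS\<close>)
  have Auc: "A *\<^sub>v u k \<in> carrier_vec n" for k using uc A by simp
  have kr: "(A ^\<^sub>m m) *\<^sub>v b \<in> carrier_vec n" for m
    by (rule mult_mat_vec_carrier[OF pow_carrier_mat[OF A(1)] b])
  have step: "u (Suc k) \<bullet> x = u k \<bullet> (A *\<^sub>v x) - l k * (u k \<bullet> x)" if "x \<in> carrier_vec n" for k x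
    using that uc[of k] Auc[of k] symmetric_mat_self_adjoint[OF A uc that]
    by (simp add: uS minus_scalar_prod_distrib[of _ n])
  \<comment> \<open>Each factor costs one of the \<open>n\<close> orthogonality relations that \<open>w\<close> satisfies.\<close>
  have ub: "u k \<bullet> ((A ^\<^sub>m m) *\<^sub>v b) = 0" if "k + m < n" for k m
    using that
  proof (induction k arbitrary: m)
    case (Suc k)
    then show ?case
      using Suc.IH[of m] Suc.IH[of "Suc m"] step[OF kr] pow_mat_Suc_mult_vec[OF A(1) b, of m]
      by simp
  qed (use w in \<open>simp add: u0\<close>)
  \<comment> \<open>The factor \<open>A - l i\<close> removes the component along \<open>v i\<close>.\<close>
  have uv: "u k \<bullet> v i = 0" if "i < k" "k \<le> n" for i k
    using that
  proof (induction k)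
    case (Suc k)
    have i: "i < n" using Suc.prems by simp
    have "u (Suc k) \<bullet> v i = (l i - l k) * (u k \<bullet> v i)"
      using step[OF vc(1)[OF i], of k] vc[OF i] uc[of k] by (simp add: algebra_simps)
    then show ?case using Suc by (cases "i = k") auto
  qed simp
  have "u n = 0\<^sub>v n"
    by (rule orthogonal_family_complete[of n v])
      (use vc orth uc uv in \<open>auto simp: comm_scalar_prod[of "v _" n "u n"]\<close>)
  define k where "k = (LEAST k. u k = 0\<^sub>v n)"
  have k: "k \<le> n" "u k = 0\<^sub>v n" "\<And>j. j < k \<Longrightarrow> u j \<noteq> 0\<^sub>v n"
    unfolding k_def using \<open>u n = 0\<^sub>v n\<close> by (auto intro: Least_le LeastI dest: not_less_Least)
  obtain j where j: "k = Suc j" using k(2) w(2) u0 by (cases k) auto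
  have "A *\<^sub>v u j = l j \<cdot>\<^sub>v u j"
  proof (rule eq_vecI)
    fix i assume "i < dim_vec (l j \<cdot>\<^sub>v u j)"
    then have i: "i < n" using uc[of j] by simp
    have "u (Suc j) $ i = 0" using k(2) j i by simp
    then show "(A *\<^sub>v u j) $ i = (l j \<cdot>\<^sub>v u j) $ i" using i uc[of j] A by (simp add: uS)
  qed (use uc[of j] A in auto)
  then have "eigenvector A (u j) (l j)" using k j uc[of j] A by (auto simp: eigenvector_def)
  moreover have "u j \<bullet> b = 0" using ub[of j 0] j k(1) A b by simp
  ultimately show ?thesis by (rule that)
qed

section \<open>Laplacian matrices\<close>

lemma laplacian_mat_carrier: "laplacian_mat n G \<in> carrier_mat n n"
  unfolding laplacian_mat_def degree_mat_def adjacency_mat_def carrier_mat_def by simp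

lemma laplacian_mat_symmetric:
  assumes "pair_graph G"
  shows "transpose_mat (laplacian_mat n G) = laplacian_mat n G"
proof -
  interpret pair_graph G by fact
  have "(u, v) \<in> parcs G \<longleftrightarrow> (v, u) \<in> parcs G" for u v
    using pair_sym_arcs by (auto simp: symmetric_def sym_def)
  then show ?thesis
    by (intro eq_matI) (auto simp: laplacian_mat_def degree_mat_def adjacency_mat_def)
qed

text \<open>The difference form of the Laplacian; all eigenvector computations below use it.\<close>

lemma laplacian_mult_vec:
  assumes V: "pverts G = {1..n}" and x: "x \<in> carrier_vec n" and i: "i < n"
  shows "(laplacian_mat n G *\<^sub>v x) $ i =
    (\<Sum>j<n. of_bool ((i + 1, j + 1) \<in> parcs G) * (x $ i - x $ j))"
proof -
  let ?a = "\<lambda>j. of_bool ((i + 1, j + 1) \<in> parcs G) :: real"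
  have "{v \<in> pverts G. (i + 1, v) \<in> parcs G} = (\<lambda>j. j + 1) ` {j \<in> {..<n}. (i + 1, j + 1) \<in> parcs G}"
  proof (intro equalityI subsetI)
    fix v assume "v \<in> {v \<in> pverts G. (i + 1, v) \<in> parcs G}"
    with V show "v \<in> (\<lambda>j. j + 1) ` {j \<in> {..<n}. (i + 1, j + 1) \<in> parcs G}"
      by (intro image_eqI[of _ _ "v - 1"]) auto
  qed (use V in auto)
  then have deg: "real (card {v \<in> pverts G. (i + 1, v) \<in> parcs G}) = (\<Sum>j<n. ?a j)"
    by (simp add: card_image inj_on_def Int_def)
  have "(laplacian_mat n G *\<^sub>v x) $ i =
      (\<Sum>j<n. ((if i = j then \<Sum>k<n. ?a k else 0) - ?a j) * x $ j)"
    using i x unfolding deg[symmetric]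
    by (auto simp: laplacian_mat_def degree_mat_def adjacency_mat_def scalar_prod_def
        atLeast0LessThan intro!: sum.cong)
  also have "\<dots> = (\<Sum>j<n. (if i = j then (\<Sum>k<n. ?a k) * x $ j else 0) - ?a j * x $ j)"
    by (intro sum.cong) (auto simp: algebra_simps)
  also have "\<dots> = (\<Sum>k<n. ?a k) * x $ i - (\<Sum>j<n. ?a j * x $ j)"
    using i by (simp add: sum_subtractf)
  finally show ?thesis by (simp add: sum_distrib_right right_diff_distrib sum_subtractf)
qed

lemma laplacian_eigenvectorI:
  assumes "pverts G = {1..n}" "x \<in> carrier_vec n" "x \<noteq> 0\<^sub>v n"
    and "\<And>i. i < n \<Longrightarrow> (\<Sum>j<n. of_bool ((i + 1, j + 1) \<in> parcs G) * (x $ i - x $ j)) = k * x $ i"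
  shows "eigenvector (laplacian_mat n G) x k"
proof -
  have "laplacian_mat n G *\<^sub>v x = k \<cdot>\<^sub>v x"
  proof (rule eq_vecI)
    fix i assume "i < dim_vec (k \<cdot>\<^sub>v x)"
    then show "(laplacian_mat n G *\<^sub>v x) $ i = (k \<cdot>\<^sub>v x) $ i"
      using assms laplacian_mult_vec[OF assms(1,2)] by simp
  qed (use laplacian_mat_carrier[of n G] assms in auto)
  then show ?thesis using assms laplacian_mat_carrier[of n G] by (auto simp: eigenvector_def)
qed

lemma laplacian_eigenvectorD:
  assumes V: "pverts G = {1..n}" and ev: "eigenvector (laplacian_mat n G) x k"
  shows "x \<in> carrier_vec n" "x \<noteq> 0\<^sub>v n"
    and "i < n \<Longrightarrow> (\<Sum>j<n. of_bool ((i + 1, j + 1) \<in> parcs G) * (x $ i - x $ j)) = k * x $ i"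
proof -
  show x: "x \<in> carrier_vec n" "x \<noteq> 0\<^sub>v n"
    using ev laplacian_mat_carrier[of n G] by (auto simp: eigenvector_def)
  assume i: "i < n"
  have "laplacian_mat n G *\<^sub>v x = k \<cdot>\<^sub>v x" using ev by (simp add: eigenvector_def)
  then show "(\<Sum>j<n. of_bool ((i + 1, j + 1) \<in> parcs G) * (x $ i - x $ j)) = k * x $ i"
    using laplacian_mult_vec[OF V x(1) i] i x(1) by simp
qed

lemma laplacian_ones_eigenvector:
  assumes "pverts G = {1..n}" "n > 0"
  shows "eigenvector (laplacian_mat n G) (vec n (\<lambda>_. 1)) 0"
proof (rule laplacian_eigenvectorI[OF assms(1)])
  show "vec n (\<lambda>_. 1 :: real) \<noteq> 0\<^sub>v n"
    using assms(2) by (metis index_vec index_zero_vec(1) zero_neq_one)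
qed auto

text \<open>The quadratic form of the Laplacian is half the sum of \<open>(x i - x j)\<^sup>2\<close> over all arcs
  \<open>(i, j)\<close>.\<close>

lemma laplacian_eigenvalue_nonneg:
  assumes G: "pair_graph G" and V: "pverts G = {1..n}" and ev: "eigenvalue (laplacian_mat n G) k"
  shows "k \<ge> 0"
proof -
  interpret pair_graph G by fact
  obtain x where "eigenvector (laplacian_mat n G) x k" using ev by (auto simp: eigenvalue_def)
  note x = laplacian_eigenvectorD[OF V this]
  define a where "a i j = (of_bool ((i + 1, j + 1) \<in> parcs G) :: real)" for i j :: nat
  have sym: "a i j = a j i" for i j
    using pair_sym_arcs by (auto simp: a_def symmetric_def sym_def)
  define S where "S = (\<Sum>i<n. \<Sum>j<n. a i j * (x $ i - x $ j) * x $ i)"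
  have "k * (x \<bullet> x) = (\<Sum>i<n. (k * x $ i) * x $ i)"
    using x(1) by (simp add: scalar_prod_def atLeast0LessThan sum_distrib_left mult.assoc)
  also have "\<dots> = S"
    unfolding S_def a_def sum_distrib_right[symmetric] by (intro sum.cong refl) (simp only: x(3) lessThan_iff)
  finally have S1: "S = k * (x \<bullet> x)" by simp
  have "S = (\<Sum>i<n. \<Sum>j<n. a i j * (x $ j - x $ i) * x $ j)"
    unfolding S_def by (subst sum.swap) (simp add: sym)
  then have "S + S = (\<Sum>i<n. \<Sum>j<n. a i j * (x $ i - x $ j) * x $ i)
      + (\<Sum>i<n. \<Sum>j<n. a i j * (x $ j - x $ i) * x $ j)"
    by (simp add: S_def)
  also have "\<dots> = (\<Sum>i<n. \<Sum>j<n. a i j * (x $ i - x $ j)\<^sup>2)"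
    unfolding sum.distrib[symmetric]
    by (intro sum.cong refl) (simp add: power2_eq_square algebra_simps)
  also have "\<dots> \<ge> 0" by (intro sum_nonneg) (simp add: a_def)
  finally have "k * (x \<bullet> x) \<ge> 0" using S1 by simp
  moreover have "x \<bullet> x \<ge> 0" by (auto simp: scalar_prod_def intro!: sum_nonneg)
  moreover have "x \<bullet> x \<noteq> 0" using scalar_prod_self_eq_0[OF x(1)] x(2) by simp
  ultimately show ?thesis by (simp add: zero_le_mult_iff)
qed

text \<open>The sum of the entries is the scalar product with the all-ones eigenvector for \<open>0\<close>.\<close>

lemma laplacian_eigenvector_sum_0:
  assumes G: "pair_graph G" and V: "pverts G = {1..n}"
    and x: "eigenvector (laplacian_mat n G) x k" and "k \<noteq> 0"
  shows "(\<Sum>i<n. x $ i) = 0"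
proof (cases "n = 0")
  case False
  note xc = laplacian_eigenvectorD(1)[OF V x]
  have "x \<bullet> vec n (\<lambda>_. 1) = 0"
    using symmetric_eigenvectors_orthogonal[OF laplacian_mat_carrier laplacian_mat_symmetric[OF G] x
        laplacian_ones_eigenvector[OF V]] False \<open>k \<noteq> 0\<close> by simp
  then show ?thesis using xc by (simp add: scalar_prod_def atLeast0LessThan)
qed simp

section \<open>The join with two isolated vertices and its spectrum\<close>

definition join_two :: "nat \<Rightarrow> nat pair_pre_digraph \<Rightarrow> nat pair_pre_digraph" where
  "join_two n G = graph_join G (empty_graph {n + 1, n + 2})"

definition pad_two :: "nat \<Rightarrow> real vec \<Rightarrow> real vec" where
  "pad_two n x = vec (n + 2) (\<lambda>i. if i < n then x $ i else 0)"

context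
  fixes n :: nat and G :: "nat pair_pre_digraph"
  assumes G: "pair_graph G" and V: "pverts G = {1..n}"
begin

interpretation pair_graph G by (rule G)

lemma arc_vertices: "(u, v) \<in> parcs G \<Longrightarrow> u \<in> {1..n} \<and> v \<in> {1..n}"
  using in_arcsD1 in_arcsD2 V by blast

lemma arc_sym: "(u, v) \<in> parcs G \<longleftrightarrow> (v, u) \<in> parcs G"
  using pair_sym_arcs by (auto simp: symmetric_def sym_def)

lemma join_two_verts: "pverts (join_two n G) = {1..n + 2}"
  by (auto simp: join_two_def graph_join_def empty_graph_def V)

lemma join_two_arcs:
  "(u, v) \<in> parcs (join_two n G) \<longleftrightarrow> (u, v) \<in> parcs G \<or>
     u \<in> {1..n} \<and> v \<in> {n + 1, n + 2} \<or> u \<in> {n + 1, n + 2} \<and> v \<in> {1..n}"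
  by (auto simp: join_two_def graph_join_def empty_graph_def V)

lemma join_two_pair_graph: "pair_graph (join_two n G)"
proof unfold_locales
  have "parcs (join_two n G) \<subseteq> {1..n + 2} \<times> {1..n + 2}"
    using arc_vertices by (force simp: join_two_arcs)
  then show "finite (parcs (join_two n G))" by (rule finite_subset) simp
  show "symmetric (with_proj (join_two n G))"
    using arc_sym by (auto simp: symmetric_def sym_def join_two_arcs)
next
  fix e assume e: "e \<in> parcs (join_two n G)"
  obtain u v where uv: "e = (u, v)" by (cases e)
  show "fst e \<in> pverts (join_two n G)" "snd e \<in> pverts (join_two n G)"
    using e arc_vertices[of u v] unfolding uv join_two_arcs join_two_verts by auto
  show "fst e \<noteq> snd e" using e pair_no_loops[of e] unfolding uv join_two_arcs by auto
qed (simp add: join_two_verts)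

lemma join_two_connected:
  assumes "n > 0"
  shows "connected (with_proj (join_two n G))"
proof -
  interpret J: pair_graph "join_two n G" by (rule join_two_pair_graph)
  let ?r = "\<lambda>u v. u \<rightarrow>\<^sup>*\<^bsub>with_proj (join_two n G)\<^esub> v"
  have arc: "?r u v" if "(u, v) \<in> parcs (join_two n G)" for u v
    using that by (intro J.reachable_adjI) simp
  have to: "?r u (n + 1)" "?r (n + 1) u" if u: "u \<in> {1..n + 2}" for u
  proof -
    have n1: "?r (n + 1) (n + 1)" by (rule J.reachable_refl) (simp add: join_two_verts)
    have n2: "?r (n + 2) (n + 1)" "?r (n + 1) (n + 2)"
      using assms by (intro J.reachable_trans[OF arc[of _ 1] arc[of 1]]; simp add: join_two_arcs)+
    have old: "?r u (n + 1)" "?r (n + 1) u" if "u \<in> {1..n}"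
      by (rule arc, use that in \<open>simp add: join_two_arcs\<close>)+
    consider "u \<in> {1..n}" | "u = n + 1" | "u = n + 2" using u by force
    then have "?r u (n + 1) \<and> ?r (n + 1) u" by cases (use n1 n2 old in blast)+
    then show "?r u (n + 1)" "?r (n + 1) u" by blast+
  qed
  show ?thesis
  proof (rule J.connectedI)
    fix u v assume "u \<in> pverts (join_two n G)" "v \<in> pverts (join_two n G)"
    then have "u \<in> {1..n + 2}" "v \<in> {1..n + 2}" by (simp_all add: join_two_verts)
    then have "?r u v" by (rule J.reachable_trans[OF to(1) to(2)])
    then show "u \<rightarrow>\<^sup>*\<^bsub>mk_symmetric (with_proj (join_two n G))\<^esub> v" by (rule J.reachable_mk_symmetricI)
  qed (simp add: join_two_verts)
qed

lemma join_two_eigenvectorI: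
  assumes x: "x \<in> carrier_vec (n + 2)" "x \<noteq> 0\<^sub>v (n + 2)"
    and old: "\<And>i. i < n \<Longrightarrow> (\<Sum>j<n. of_bool ((i + 1, j + 1) \<in> parcs G) * (x $ i - x $ j))
      + (x $ i - x $ n) + (x $ i - x $ (n + 1)) = k * x $ i"
    and new: "\<And>i. i \<in> {n, n + 1} \<Longrightarrow> (\<Sum>j<n. x $ i - x $ j) = k * x $ i"
  shows "eigenvector (laplacian_mat (n + 2) (join_two n G)) x k"
proof (rule laplacian_eigenvectorI[OF join_two_verts x])
  fix i assume i: "i < n + 2"
  have split: "(\<Sum>j<n + 2. f j) = (\<Sum>j<n. f j) + f n + f (n + 1)" for f :: "nat \<Rightarrow> real"
    by (simp add: numeral_2_eq_2)
  have noarc: "(Suc i, Suc j) \<notin> parcs G" if "i \<ge> n \<or> j \<ge> n" for i j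
    using arc_vertices[of "Suc i" "Suc j"] that by auto
  consider "i < n" | "i = n" | "i = n + 1" using i by linarith
  then show "(\<Sum>j<n + 2. of_bool ((i + 1, j + 1) \<in> parcs (join_two n G)) * (x $ i - x $ j)) = k * x $ i"
  proof cases
    case 1
    then show ?thesis using old[OF 1] by (simp add: split join_two_arcs noarc algebra_simps del: sum_of_bool_mult_eq)
  next
    case 2
    then show ?thesis using new[of i] by (simp add: split join_two_arcs noarc del: sum_of_bool_mult_eq)
  next
    case 3
    then show ?thesis using new[of i] by (simp add: split join_two_arcs noarc del: sum_of_bool_mult_eq)
  qed
qed

text \<open>The two new vertices raise every old degree by 2, and their rows see only the sum of the
  entries.\<close>

lemma pad_two_eigenvector:
  assumes x: "eigenvector (laplacian_mat n G) x k" and s: "(\<Sum>i<n. x $ i) = 0"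
  shows "eigenvector (laplacian_mat (n + 2) (join_two n G)) (pad_two n x) (k + 2)"
proof (rule join_two_eigenvectorI)
  note xD = laplacian_eigenvectorD[OF V x]
  obtain i where "i < n" "x $ i \<noteq> 0" using xD(1,2) by (metis carrier_vecD eq_vecI index_zero_vec)
  then have "pad_two n x $ i \<noteq> 0\<^sub>v (n + 2) $ i" by (simp add: pad_two_def)
  then show "pad_two n x \<noteq> 0\<^sub>v (n + 2)" by metis
  fix i assume "i < n"
  then show "(\<Sum>j<n. of_bool ((i + 1, j + 1) \<in> parcs G) * (pad_two n x $ i - pad_two n x $ j))
      + (pad_two n x $ i - pad_two n x $ n) + (pad_two n x $ i - pad_two n x $ (n + 1)) = (k + 2) * pad_two n x $ i"
    using xD(3)[of i] by (simp add: pad_two_def algebra_simps del: sum_of_bool_mult_eq)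
next
  fix i assume "i \<in> {n, n + 1}"
  then show "(\<Sum>j<n. pad_two n x $ i - pad_two n x $ j) = (k + 2) * pad_two n x $ i"
    using s by (auto simp: pad_two_def sum_negf)
qed (simp add: pad_two_def)

lemma join_two_difference_eigenvector:
  "eigenvector (laplacian_mat (n + 2) (join_two n G))
     (vec (n + 2) (\<lambda>i. if i = n then 1 else if i = n + 1 then - 1 else 0)) (real n)"
    (is "eigenvector _ ?x _")
proof (rule join_two_eigenvectorI)
  have "?x $ n \<noteq> 0\<^sub>v (n + 2) $ n" by simp
  then show "?x \<noteq> 0\<^sub>v (n + 2)" by metis
qed auto

text \<open>The values \<open>2\<close> and \<open>-n\<close> on the two sides of the join are what orthogonality to the
  all-ones vector dictates, up to a common factor.\<close>

lemma join_two_cut_eigenvector: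
  assumes "n > 0"
  shows "eigenvector (laplacian_mat (n + 2) (join_two n G))
     (vec (n + 2) (\<lambda>i. if i < n then 2 else - real n)) (real n + 2)"
    (is "eigenvector _ ?x _")
proof (rule join_two_eigenvectorI)
  have "?x $ 0 \<noteq> 0\<^sub>v (n + 2) $ 0" using assms by simp
  then show "?x \<noteq> 0\<^sub>v (n + 2)" by metis
qed (auto simp: algebra_simps)

end

lemma pad_two_scalar_prod:
  assumes "x \<in> carrier_vec n" "y \<in> carrier_vec (n + 2)"
  shows "pad_two n x \<bullet> y = (\<Sum>i<n. x $ i * y $ i)"
  using assms by (simp add: scalar_prod_def pad_two_def atLeast0LessThan numeral_2_eq_2)

context
  fixes n :: nat and G :: "nat pair_pre_digraph"
  assumes G: "pair_graph G" and V: "pverts G = {1..n}"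
begin

lemma join_two_laplacian:
  "laplacian_mat (n + 2) (join_two n G) \<in> carrier_mat (n + 2) (n + 2)"
  "transpose_mat (laplacian_mat (n + 2) (join_two n G)) = laplacian_mat (n + 2) (join_two n G)"
  by (rule laplacian_mat_carrier, rule laplacian_mat_symmetric[OF join_two_pair_graph[OF G V]])

text \<open>The spectrum of the join is \<open>{0, n, n + 2}\<close> together with \<open>k + 2\<close> for the nonzero eigenvalues
  \<open>k\<close> of \<open>G\<close>. These \<open>n + 2\<close> numbers are distinct exactly if no \<open>k + 2\<close> equals \<open>n\<close> or \<open>n + 2\<close>;
  a coincidence yields two orthogonal eigenvectors for one eigenvalue. The bound on \<open>n\<close>
  excludes in particular \<open>n = 2\<close>, where \<open>n - 2\<close> is the eigenvalue \<open>0\<close> of the all-ones vector, which is not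
  shifted by 2.\<close>

lemma join_two_simple_spectrum_iff:
  assumes simple: "simple_spectrum (laplacian_mat n G)" and n: "n > 2"
  shows "simple_spectrum (laplacian_mat (n + 2) (join_two n G)) \<longleftrightarrow>
    \<not> eigenvalue (laplacian_mat n G) (real n - 2) \<and> \<not> eigenvalue (laplacian_mat n G) (real n)"
proof (intro iffI conjI notI)
  assume simple': "simple_spectrum (laplacian_mat (n + 2) (join_two n G))"
  note no_orth = simple_spectrum_no_orthogonal_eigenvectors[OF join_two_laplacian simple']
  {
    assume "eigenvalue (laplacian_mat n G) (real n - 2)"
    then obtain x where x: "eigenvector (laplacian_mat n G) x (real n - 2)" by (auto simp: eigenvalue_def)
    have "(\<Sum>i<n. x $ i) = 0" using laplacian_eigenvector_sum_0[OF G V x] n by simp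
    from pad_two_eigenvector[OF G V x this]
    have "eigenvector (laplacian_mat (n + 2) (join_two n G)) (pad_two n x) (real n)" by simp
    from no_orth[OF this join_two_difference_eigenvector[OF G V]]
    show False using laplacian_eigenvectorD(1)[OF V x] by (simp add: pad_two_scalar_prod)
  next
    assume "eigenvalue (laplacian_mat n G) (real n)"
    then obtain x where x: "eigenvector (laplacian_mat n G) x (real n)" by (auto simp: eigenvalue_def)
    have s: "(\<Sum>i<n. x $ i) = 0" using laplacian_eigenvector_sum_0[OF G V x] n by simp
    have "eigenvector (laplacian_mat (n + 2) (join_two n G))
        (vec (n + 2) (\<lambda>i. if i < n then 2 else - real n)) (real n + 2)"
      using join_two_cut_eigenvector[OF G V] n by simp
    from no_orth[OF pad_two_eigenvector[OF G V x s] this]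
    show False using laplacian_eigenvectorD(1)[OF V x] s
      by (simp add: pad_two_scalar_prod sum_distrib_right[symmetric])
  }
next
  let ?L = "laplacian_mat n G" and ?L' = "laplacian_mat (n + 2) (join_two n G)"
  assume "\<not> eigenvalue ?L (real n - 2) \<and> \<not> eigenvalue ?L (real n)"
  then have ev: "\<not> eigenvalue ?L (real n - 2)" "\<not> eigenvalue ?L (real n)" by auto
  define E where "E = {k. eigenvalue ?L k}"
  have E: "finite E" "card E = n"
    using finite_card_eigenvalues(1)[OF laplacian_mat_carrier] simple
      simple_spectrum_iff_card[OF laplacian_mat_carrier laplacian_mat_symmetric[OF G]]
    by (simp_all add: E_def)
  have "0 \<in> E" using laplacian_ones_eigenvector[OF V] n by (auto simp: E_def eigenvalue_def)
  let ?F = "(\<lambda>k. k + 2) ` (E - {0})"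
  have F: "card ?F = n - 1" "finite ?F"
    using E \<open>0 \<in> E\<close> by (simp_all add: card_image inj_on_def card_Diff_singleton)
  have "k \<ge> 0" if "k \<in> E" for k using laplacian_eigenvalue_nonneg[OF G V] that by (simp add: E_def)
  then have "0 \<notin> ?F" by force
  moreover have "real n \<notin> ?F" using ev(1) by (force simp: E_def)
  moreover have "real n + 2 \<notin> ?F" using ev(2) by (auto simp: E_def)
  ultimately have "card ({0, real n, real n + 2} \<union> ?F) = n + 2" using F n by simp
  moreover have "{0, real n, real n + 2} \<union> ?F \<subseteq> {k. eigenvalue ?L' k}"
  proof -
    have "eigenvalue ?L' (k + 2)" if k: "k \<in> E" "k \<noteq> 0" for k
    proof -
      obtain x where x: "eigenvector ?L x k" using k by (auto simp: E_def eigenvalue_def)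
      from pad_two_eigenvector[OF G V x laplacian_eigenvector_sum_0[OF G V x k(2)]]
      show ?thesis by (auto simp: eigenvalue_def)
    qed
    moreover have "eigenvalue ?L' 0"
      using laplacian_ones_eigenvector[OF join_two_verts[OF G V]] unfolding eigenvalue_def by fastforce
    moreover have "eigenvalue ?L' (real n)" "eigenvalue ?L' (real n + 2)"
      using join_two_difference_eigenvector[OF G V] join_two_cut_eigenvector[OF G V] n
      unfolding eigenvalue_def by fastforce+
    ultimately show ?thesis by auto
  qed
  ultimately have "card {k. eigenvalue ?L' k} = n + 2"
    using card_mono finite_card_eigenvalues[OF join_two_laplacian(1)] by (metis le_antisym)
  then show "simple_spectrum ?L'" by (simp only: simple_spectrum_iff_card[OF join_two_laplacian])
qed

end

section \<open>Controllability of the join\<close>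

text \<open>On one or two vertices, a Laplacian with simple spectrum is controlled by the first unit
  vector: an eigenvector
  \<open>v\<close> orthogonal to it would be supported on the second vertex, and the first row of the
  eigenvector equation then shows that the two vertices are not adjacent, so that \<open>0\<close> is a double
  eigenvalue.\<close>

lemma strongly_uncontrollable_gt_2:
  assumes "strongly_uncontrollable n G"
  shows "n > 2"
proof -
  have G: "pair_graph G" and V: "pverts G = {1..n}" and conn: "connected (with_proj G)"
    and simple: "simple_spectrum (laplacian_mat n G)"
    and unc: "\<And>b. b \<in> carrier_vec n \<Longrightarrow> (\<And>i. i < n \<Longrightarrow> b $ i \<in> {0, 1}) \<Longrightarrow>
      \<not> controllable n (laplacian_mat n G) b"
    using assms by (auto simp: strongly_uncontrollable_def)
  note L = laplacian_mat_carrier laplacian_mat_symmetric[OF G]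
  have "n > 0"
    using conn V by (auto simp: connected_def strongly_connected_def)
  obtain v k where v: "eigenvector (laplacian_mat n G) v k" and v0: "v \<bullet> unit_vec n 0 = 0"
    by (rule not_controllable_imp_orthogonal[OF L simple _ unc[of "unit_vec n 0"]])
      (auto simp: unit_vec_def)
  note vD = laplacian_eigenvectorD[OF V v]
  have v0: "v $ 0 = 0" using v0 \<open>n > 0\<close> by simp
  have "n \<noteq> 1" using vD(1,2) v0 by (auto intro!: eq_vecI)
  moreover have "n \<noteq> 2"
  proof
    assume n2: "n = 2"
    have "v $ 1 \<noteq> 0" using vD(1,2) v0 n2 by (auto intro!: eq_vecI simp: less_2_cases_iff)
    then have "(1, 2) \<notin> parcs G" using vD(3)[of 0] v0 n2
      by (auto simp: numeral_2_eq_2 split: if_splits)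
    moreover from this have "(2, 1) \<notin> parcs G" using arc_sym[OF G V] by blast
    ultimately have noarc: "(1, Suc 1) \<notin> parcs G" "(Suc 1, 1) \<notin> parcs G" by (simp_all add: numeral_2_eq_2)
    let ?y = "vec n (\<lambda>i. if i = 0 then 1 else - 1 :: real)"
    have "eigenvector (laplacian_mat n G) ?y 0"
    proof (rule laplacian_eigenvectorI[OF V])
      have "?y $ 0 \<noteq> 0\<^sub>v n $ 0" using n2 by simp
      then show "?y \<noteq> 0\<^sub>v n" by metis
    qed (use noarc n2 in \<open>auto simp: numeral_2_eq_2 less_Suc_eq\<close>)
    from simple_spectrum_no_orthogonal_eigenvectors[OF L simple this laplacian_ones_eigenvector[OF V]]
    show False using n2 by (simp add: scalar_prod_def numeral_2_eq_2)
  qed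
  ultimately show ?thesis using \<open>n > 0\<close> by linarith
qed

text \<open>Subtracting the mean from \<open>x\<close> leaves a kernel vector orthogonal to the all-ones vector,
  which is \<open>0\<close> by simplicity of the eigenvalue \<open>0\<close>.\<close>

lemma simple_laplacian_kernel:
  assumes G: "pair_graph G" and V: "pverts G = {1..n}" and simple: "simple_spectrum (laplacian_mat n G)"
    and x: "eigenvector (laplacian_mat n G) x 0"
  obtains c where "c \<noteq> 0" "\<And>i. i < n \<Longrightarrow> x $ i = c"
proof -
  note xD = laplacian_eigenvectorD[OF V x]
  have "n > 0" using xD(1,2) by (cases n) auto
  define c where "c = (\<Sum>i<n. x $ i) / n"
  define y where "y = vec n (\<lambda>i. x $ i - c)"
  have yc: "y \<in> carrier_vec n" by (simp add: y_def)
  have "y = 0\<^sub>v n"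
  proof (rule ccontr)
    assume "y \<noteq> 0\<^sub>v n"
    then have "eigenvector (laplacian_mat n G) y 0"
    proof (rule laplacian_eigenvectorI[OF V yc])
      fix i assume i: "i < n"
      then show "(\<Sum>j<n. of_bool ((i + 1, j + 1) \<in> parcs G) * (y $ i - y $ j)) = 0 * y $ i"
        using xD(3)[OF i] by (simp add: y_def del: sum_of_bool_mult_eq)
    qed
    from simple_spectrum_no_orthogonal_eigenvectors[OF laplacian_mat_carrier
        laplacian_mat_symmetric[OF G] simple this laplacian_ones_eigenvector[OF V \<open>n > 0\<close>]]
    show False using \<open>n > 0\<close>
      by (simp add: scalar_prod_def y_def atLeast0LessThan sum_subtractf c_def)
  qed
  have xi: "x $ i = c" if "i < n" for i
    using that arg_cong[OF \<open>y = 0\<^sub>v n\<close>, of "\<lambda>w. w $ i"] by (simp add: y_def)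
  have "c \<noteq> 0" using xi xD(1,2) by (auto intro!: eq_vecI)
  then show ?thesis using xi by (rule that)
qed

text \<open>The restriction \<open>c\<close> of \<open>b\<close> to the old vertices is orthogonal to some eigenvector of \<open>G\<close>, and padding that eigenvector
  with zeros gives an eigenvector of the join orthogonal to \<open>b\<close>, unless its eigenvalue is \<open>0\<close>.
  In that case it is constant, which forces \<open>c = 0\<close>, and any eigenvector of \<open>G\<close> for a
  nonzero eigenvalue serves instead.\<close>

lemma join_two_not_controllable:
  assumes su: "strongly_uncontrollable n G"
    and b: "b \<in> carrier_vec (n + 2)" "\<forall>i<n + 2. b $ i \<in> {0, 1}"
  shows "\<not> controllable (n + 2) (laplacian_mat (n + 2) (join_two n G)) b"
proof -
  have G: "pair_graph G" and V: "pverts G = {1..n}" and simple: "simple_spectrum (laplacian_mat n G)"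
    and unc: "\<And>b. b \<in> carrier_vec n \<Longrightarrow> (\<And>i. i < n \<Longrightarrow> b $ i \<in> {0, 1}) \<Longrightarrow>
      \<not> controllable n (laplacian_mat n G) b"
    using su by (auto simp: strongly_uncontrollable_def)
  have n: "n > 2" using su by (rule strongly_uncontrollable_gt_2)
  note L = laplacian_mat_carrier[of n G] laplacian_mat_symmetric[OF G, of n]
  note not_ctrl = not_controllable_if_orthogonal[OF join_two_laplacian[OF G V] b(1)]
  define c where "c = vec n (\<lambda>i. b $ i)"
  have cc: "c \<in> carrier_vec n" by (simp add: c_def)
  have pad: ?thesis if x: "eigenvector (laplacian_mat n G) x k" and "k \<noteq> 0" and xc: "x \<bullet> c = 0" for x k
  proof (rule not_ctrl)
    show "eigenvector (laplacian_mat (n + 2) (join_two n G)) (pad_two n x) (k + 2)"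
      by (rule pad_two_eigenvector[OF G V x laplacian_eigenvector_sum_0[OF G V x \<open>k \<noteq> 0\<close>]])
    show "pad_two n x \<bullet> b = 0"
      using xc pad_two_scalar_prod[OF laplacian_eigenvectorD(1)[OF V x] b(1)]
      by (simp add: scalar_prod_def c_def atLeast0LessThan)
  qed
  obtain v k where v: "eigenvector (laplacian_mat n G) v k" and vc: "v \<bullet> c = 0"
    by (rule not_controllable_imp_orthogonal[OF L simple cc unc[OF cc]])
      (use b in \<open>auto simp: c_def\<close>)
  show ?thesis
  proof (cases "k = 0")
    case False
    then show ?thesis using pad[OF v _ vc] by simp
  next
    case True
    obtain d where d: "d \<noteq> 0" "\<And>i. i < n \<Longrightarrow> v $ i = d"
      using simple_laplacian_kernel[OF G V simple] v True by metis
    have "v \<bullet> c = d * (\<Sum>i<n. b $ i)"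
      using d(2) by (simp add: scalar_prod_def c_def atLeast0LessThan sum_distrib_left)
    then have "(\<Sum>i<n. b $ i) = 0" using vc d(1) by simp
    moreover have "b $ i \<ge> 0" if "i < n" for i
    proof -
      have "b $ i \<in> {0, 1}" using b(2) that by simp
      then show ?thesis by auto
    qed
    ultimately have "\<forall>i<n. b $ i = 0" by (subst (asm) sum_nonneg_eq_0_iff) auto
    then have "c = 0\<^sub>v n" by (auto simp: c_def)
    have "card {k. eigenvalue (laplacian_mat n G) k} = n" using simple simple_spectrum_iff_card[OF L] by simp
    then have "\<not> {k. eigenvalue (laplacian_mat n G) k} \<subseteq> {0}"
      using n card_mono[of "{0 :: real}" "{k. eigenvalue (laplacian_mat n G) k}"] by auto
    then obtain k' x where "k' \<noteq> 0" "eigenvector (laplacian_mat n G) x k'" by (auto simp: eigenvalue_def)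
    then show ?thesis
      using pad[of x k'] laplacian_eigenvectorD(1)[OF V] \<open>c = 0\<^sub>v n\<close> by simp
  qed
qed

lemma join_two_strongly_uncontrollable_iff:
  assumes su: "strongly_uncontrollable n G"
  shows "strongly_uncontrollable (n + 2) (join_two n G) \<longleftrightarrow>
    \<not> eigenvalue (laplacian_mat n G) (real n - 2) \<and> \<not> eigenvalue (laplacian_mat n G) (real n)"
proof -
  have G: "pair_graph G" and V: "pverts G = {1..n}" and simple: "simple_spectrum (laplacian_mat n G)"
    using su by (auto simp: strongly_uncontrollable_def)
  have n: "n > 2" using su by (rule strongly_uncontrollable_gt_2)
  then show ?thesis
    unfolding join_two_simple_spectrum_iff[OF G V simple n, symmetric]
    using join_two_pair_graph[OF G V] join_two_verts[OF G V] join_two_connected[OF G V]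
      join_two_not_controllable[OF su]
    by (auto simp: strongly_uncontrollable_def)
qed

section \<open>Automorphisms of the join\<close>

lemma aut_group_carrier:
  "p \<in> carrier (aut_group G) \<longleftrightarrow> p permutes pverts G \<and>
     (\<forall>u \<in> pverts G. \<forall>v \<in> pverts G. (p u, p v) \<in> parcs G \<longleftrightarrow> (u, v) \<in> parcs G)"
  by (simp add: aut_group_def)

lemma aut_group_mult: "p \<otimes>\<^bsub>aut_group G\<^esub> q = p \<circ> q"
  by (simp add: aut_group_def)

lemma aut_group_group: "group (aut_group G)"
proof (rule groupI)
  fix p q assume "p \<in> carrier (aut_group G)" "q \<in> carrier (aut_group G)"
  then show "p \<otimes>\<^bsub>aut_group G\<^esub> q \<in> carrier (aut_group G)"
    by (auto simp: aut_group_carrier aut_group_mult permutes_compose permutes_in_image)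
next
  fix p assume p: "p \<in> carrier (aut_group G)"
  then have perm: "p permutes pverts G" by (simp add: aut_group_carrier)
  have "inv_into UNIV p \<in> carrier (aut_group G)"
    unfolding aut_group_carrier
  proof (intro conjI ballI)
    fix u v assume "u \<in> pverts G" "v \<in> pverts G"
    then have "inv_into UNIV p u \<in> pverts G" "inv_into UNIV p v \<in> pverts G"
      using permutes_in_image[OF permutes_inv[OF perm]] by auto
    then have "(p (inv_into UNIV p u), p (inv_into UNIV p v)) \<in> parcs G \<longleftrightarrow>
        (inv_into UNIV p u, inv_into UNIV p v) \<in> parcs G"
      using p by (simp add: aut_group_carrier)
    then show "(inv_into UNIV p u, inv_into UNIV p v) \<in> parcs G \<longleftrightarrow> (u, v) \<in> parcs G"
      by (simp add: permutes_inverses(1)[OF perm])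
  qed (rule permutes_inv[OF perm])
  moreover have "inv_into UNIV p \<otimes>\<^bsub>aut_group G\<^esub> p = \<one>\<^bsub>aut_group G\<^esub>"
    using permutes_inv_o(2)[OF perm] by (simp add: aut_group_def)
  ultimately show "\<exists>q\<in>carrier (aut_group G). q \<otimes>\<^bsub>aut_group G\<^esub> p = \<one>\<^bsub>aut_group G\<^esub>" by blast
qed (auto simp: aut_group_def permutes_id)

text \<open>The eigenvector is the difference of the indicators of \<open>v\<close> and \<open>w\<close>: both have degree
  \<open>n - 2\<close>, and at any other vertex the two contributions cancel.\<close>

lemma twins_eigenvector:
  assumes V: "pverts G = {1..n}" and vw: "v \<in> {1..n}" "w \<in> {1..n}" "v \<noteq> w"
    and arcs: "\<And>u. u \<in> {1..n} \<Longrightarrow> (u, v) \<in> parcs G \<longleftrightarrow> u \<notin> {v, w}"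
      "\<And>u. u \<in> {1..n} \<Longrightarrow> (u, w) \<in> parcs G \<longleftrightarrow> u \<notin> {v, w}"
      "\<And>u. u \<in> {1..n} \<Longrightarrow> (v, u) \<in> parcs G \<longleftrightarrow> u \<notin> {v, w}"
      "\<And>u. u \<in> {1..n} \<Longrightarrow> (w, u) \<in> parcs G \<longleftrightarrow> u \<notin> {v, w}"
  shows "eigenvalue (laplacian_mat n G) (real n - 2)"
proof -
  obtain s t where st: "v = s + 1" "w = t + 1" "s < n" "t < n" "s \<noteq> t"
    using vw by (metis Suc_eq_plus1 Suc_le_eq atLeastAtMost_iff le_add_diff_inverse2)
  define x where "x = vec n (\<lambda>i. of_bool (i = s) - of_bool (i = t) :: real)"
  have xi: "x $ i = of_bool (i = s) - of_bool (i = t)" if "i < n" for i using that by (simp add: x_def)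
  have card: "(\<Sum>j<n. of_bool (j \<noteq> s \<and> j \<noteq> t)) = real n - 2"
  proof -
    have "{..<n} \<inter> {j. j \<noteq> s \<and> j \<noteq> t} = {..<n} - {s, t}" by auto
    moreover have "card ({..<n} - {s, t}) = n - 2" using st by (simp add: card_Diff_subset)
    ultimately show ?thesis using st by simp
  qed
  have "eigenvector (laplacian_mat n G) x (real n - 2)"
  proof (rule laplacian_eigenvectorI[OF V])
    have "x $ s \<noteq> 0\<^sub>v n $ s" using st by (simp add: xi)
    then show "x \<noteq> 0\<^sub>v n" by metis
    fix i assume i: "i < n"
    let ?S = "\<Sum>j<n. of_bool ((i + 1, j + 1) \<in> parcs G) * (x $ i - x $ j)"
    consider "i = s" | "i = t" | "i \<noteq> s" "i \<noteq> t" by blast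
    then show "?S = (real n - 2) * x $ i"
    proof cases
      case 1
      have "?S = (\<Sum>j<n. of_bool (j \<noteq> s \<and> j \<noteq> t))"
        using st arcs(3) 1 by (intro sum.cong refl) (auto simp: xi)
      then show ?thesis using card 1 st by (simp add: xi del: sum_of_bool_eq)
    next
      case 2
      have "?S = (\<Sum>j<n. - of_bool (j \<noteq> s \<and> j \<noteq> t))"
        using st arcs(4) 2 by (intro sum.cong refl) (auto simp: xi)
      then show ?thesis using card 2 st by (simp add: xi sum_negf del: sum_of_bool_eq)
    next
      case 3
      have "?S = (\<Sum>j<n. of_bool (j = t) - of_bool (j = s))"
        using st arcs(1,2)[of "i + 1"] 3 i by (intro sum.cong refl) (auto simp: xi)
      also have "\<dots> = 0" using st by (simp add: sum_subtractf of_bool_def)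
      finally show ?thesis using 3 i by (simp add: xi)
    qed
  qed (simp add: x_def)
  then show ?thesis by (auto simp: eigenvalue_def)
qed

context
  fixes n :: nat and G :: "nat pair_pre_digraph"
  assumes G: "pair_graph G" and V: "pverts G = {1..n}"
begin

lemma join_two_aut_extend:
  assumes "p \<in> carrier (aut_group G)"
  shows "p \<in> carrier (aut_group (join_two n G))"
proof -
  have perm: "p permutes {1..n}"
    and arcs: "\<And>u v. u \<in> {1..n} \<Longrightarrow> v \<in> {1..n} \<Longrightarrow> (p u, p v) \<in> parcs G \<longleftrightarrow> (u, v) \<in> parcs G"
    using assms V by (auto simp: aut_group_carrier)
  have "p permutes {1..n + 2}" by (rule permutes_subset[OF perm]) auto
  moreover have "(p u, p v) \<in> parcs (join_two n G) \<longleftrightarrow> (u, v) \<in> parcs (join_two n G)" for u v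
  proof -
    have old: "(p u, p v) \<in> parcs G \<longleftrightarrow> (u, v) \<in> parcs G"
      using arcs[of u v] arc_vertices[OF G V] permutes_in_image[OF perm] by blast
    have "p (n + 1) = n + 1" "p (n + 2) = n + 2" using permutes_not_in[OF perm] by auto
    then have new: "p w \<in> {n + 1, n + 2} \<longleftrightarrow> w \<in> {n + 1, n + 2}" for w
      using inj_eq[OF permutes_inj[OF perm], of w "n + 1"] inj_eq[OF permutes_inj[OF perm], of w "n + 2"]
      by simp
    show ?thesis by (simp only: join_two_arcs[OF G V] old new permutes_in_image[OF perm])
  qed
  ultimately show ?thesis by (simp add: aut_group_carrier join_two_verts[OF G V])
qed

lemma join_two_aut_restrict:
  assumes p: "p \<in> carrier (aut_group (join_two n G))" and fix_new: "p (n + 1) = n + 1" "p (n + 2) = n + 2"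
  shows "p \<in> carrier (aut_group G)"
proof -
  have "p permutes {1..n + 2}" using p by (simp add: aut_group_carrier join_two_verts[OF G V])
  then have perm: "p permutes {1..n}"
    by (rule permutes_superset) (use fix_new in \<open>auto simp: le_Suc_eq\<close>)
  have "(p u, p v) \<in> parcs G \<longleftrightarrow> (u, v) \<in> parcs G" if uv: "u \<in> {1..n}" "v \<in> {1..n}" for u v
  proof -
    have "(p u, p v) \<in> parcs (join_two n G) \<longleftrightarrow> (u, v) \<in> parcs (join_two n G)"
      using p uv by (simp add: aut_group_carrier join_two_verts[OF G V])
    moreover have "p u \<in> {1..n}" "p v \<in> {1..n}" using uv permutes_in_image[OF perm] by auto
    ultimately show ?thesis using uv by (auto simp: join_two_arcs[OF G V])
  qed
  with perm V show ?thesis by (simp add: aut_group_carrier)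
qed

lemma join_two_swap_aut:
  "Transposition.transpose (n + 1) (n + 2) \<in> carrier (aut_group (join_two n G))"
    (is "?t \<in> _")
proof -
  have "?t permutes {1..n + 2}" by (rule permutes_swap_id) auto
  moreover have "(?t u, ?t v) \<in> parcs (join_two n G) \<longleftrightarrow> (u, v) \<in> parcs (join_two n G)" for u v
  proof -
    have fixed: "?t w = w" if "w \<in> {1..n}" for w
      using that by (intro transpose_apply_other) auto
    have new: "?t w \<in> {n + 1, n + 2} \<longleftrightarrow> w \<in> {n + 1, n + 2}" for w
      by (auto simp: Transposition.transpose_def)
    have V_iff: "?t w \<in> {1..n} \<longleftrightarrow> w \<in> {1..n}" for w
      by (auto simp: Transposition.transpose_def)
    have old: "(?t u, ?t v) \<in> parcs G \<longleftrightarrow> (u, v) \<in> parcs G"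
    proof (cases "u \<in> {1..n} \<and> v \<in> {1..n}")
      case False
      then show ?thesis using arc_vertices[OF G V] V_iff by blast
    qed (simp add: fixed)
    show ?thesis by (simp only: join_two_arcs[OF G V] old new V_iff)
  qed
  ultimately show ?thesis by (simp add: aut_group_carrier join_two_verts[OF G V])
qed

text \<open>The vertices \<open>n + 1\<close> and \<open>n + 2\<close> are non-adjacent and adjacent to everything else. If an
  automorphism moved one of them to an old vertex \<open>v\<close>, the other would go to an old vertex \<open>w\<close> too,
  because \<open>v\<close> is adjacent to both new vertices. Then \<open>v\<close> and \<open>w\<close> would be such a pair within
  \<open>G\<close>, and \<open>n - 2\<close> would be an eigenvalue.\<close>

lemma join_two_aut_new_vertices:
  assumes p: "p \<in> carrier (aut_group (join_two n G))"
    and ev: "\<not> eigenvalue (laplacian_mat n G) (real n - 2)"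
  shows "p (n + 1) \<in> {n + 1, n + 2}"
proof (rule ccontr)
  assume v: "p (n + 1) \<notin> {n + 1, n + 2}"
  have perm: "p permutes {1..n + 2}"
    and arcs: "\<And>u v. u \<in> {1..n + 2} \<Longrightarrow> v \<in> {1..n + 2} \<Longrightarrow>
      (p u, p v) \<in> parcs (join_two n G) \<longleftrightarrow> (u, v) \<in> parcs (join_two n G)"
    using p unfolding aut_group_carrier join_two_verts[OF G V] by blast+
  have noarc: "u \<notin> {1..n} \<or> v \<notin> {1..n} \<Longrightarrow> (u, v) \<notin> parcs G" for u v
    using arc_vertices[OF G V] by blast
  define v where "v = p (n + 1)"
  define w where "w = p (n + 2)"
  have "v \<in> {1..n + 2}" "w \<in> {1..n + 2}"
    unfolding v_def w_def permutes_in_image[OF perm] by auto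
  then have v_old: "v \<in> {1..n}" using v by (auto simp: v_def)
  have "(v, w) \<notin> parcs (join_two n G)"
    unfolding v_def w_def using arcs[of "n + 1" "n + 2"] noarc by (auto simp: join_two_arcs[OF G V])
  then have w_old: "w \<in> {1..n}" using v_old \<open>w \<in> {1..n + 2}\<close> by (auto simp: join_two_arcs[OF G V])
  have "v \<noteq> w" by (simp add: v_def w_def inj_eq[OF permutes_inj[OF perm]])
  have twin: "(u, p m) \<in> parcs G \<longleftrightarrow> u \<notin> {v, w}"
    if u: "u \<in> {1..n}" and m: "m \<in> {n + 1, n + 2}" and pm: "p m \<in> {1..n}" for u m
  proof -
    obtain u' where u': "u = p u'" using permutes_surj[OF perm] by (metis surjD)
    have u'V: "u' \<in> {1..n + 2}" using u permutes_in_image[OF perm, of u'] by (auto simp: u')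
    have "u \<in> {v, w} \<longleftrightarrow> u' \<in> {n + 1, n + 2}" by (simp add: u' v_def w_def inj_eq[OF permutes_inj[OF perm]])
    moreover have "(u, p m) \<in> parcs G \<longleftrightarrow> (u, p m) \<in> parcs (join_two n G)"
      using u pm by (auto simp: join_two_arcs[OF G V])
    moreover have "(u, p m) \<in> parcs (join_two n G) \<longleftrightarrow> (u', m) \<in> parcs (join_two n G)"
      unfolding u' using m by (intro arcs u'V) auto
    moreover have "(u', m) \<in> parcs (join_two n G) \<longleftrightarrow> u' \<notin> {n + 1, n + 2}"
      using u'V m noarc[of u' m] by (auto simp: join_two_arcs[OF G V])
    ultimately show ?thesis by blast
  qed
  have "eigenvalue (laplacian_mat n G) (real n - 2)"
  proof (rule twins_eigenvector[OF V v_old w_old \<open>v \<noteq> w\<close>])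
    fix u assume u: "u \<in> {1..n}"
    show "(u, v) \<in> parcs G \<longleftrightarrow> u \<notin> {v, w}" "(u, w) \<in> parcs G \<longleftrightarrow> u \<notin> {v, w}"
      using twin[OF u] v_old w_old by (auto simp: v_def w_def)
    then show "(v, u) \<in> parcs G \<longleftrightarrow> u \<notin> {v, w}" "(w, u) \<in> parcs G \<longleftrightarrow> u \<notin> {v, w}"
      using arc_sym[OF G V] by blast+
  qed
  with ev show False by blast
qed

lemma join_two_aut_cases:
  assumes p: "p \<in> carrier (aut_group (join_two n G))"
    and ev: "\<not> eigenvalue (laplacian_mat n G) (real n - 2)"
  obtains "p \<in> carrier (aut_group G)"
  | q where "q \<in> carrier (aut_group G)" "p = Transposition.transpose (n + 1) (n + 2) \<circ> q"
proof -
  interpret A: group "aut_group (join_two n G)" by (rule aut_group_group)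
  let ?t = "Transposition.transpose (n + 1) (n + 2)"
  have t: "?t \<in> carrier (aut_group (join_two n G))" by (rule join_two_swap_aut)
  have "inj p" using p by (auto simp: aut_group_carrier permutes_inj)
  then have ne: "p (n + 1) \<noteq> p (n + 2)" by (simp add: inj_eq)
  have p1: "p (n + 1) \<in> {n + 1, n + 2}" by (rule join_two_aut_new_vertices[OF p ev])
  have p2: "p (n + 2) \<in> {n + 1, n + 2}"
    using join_two_aut_new_vertices[OF A.m_closed[OF p t] ev] by (simp add: aut_group_mult)
  show ?thesis
  proof (cases "p (n + 1) = n + 1")
    case True
    then have "p (n + 2) = n + 2" using p2 ne by auto
    with True p show ?thesis by (intro that(1) join_two_aut_restrict)
  next
    case False
    then have sw: "p (n + 1) = n + 2" "p (n + 2) = n + 1" using p1 p2 ne by auto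
    have "?t \<circ> p \<in> carrier (aut_group (join_two n G))"
      using A.m_closed[OF t p] by (simp add: aut_group_mult)
    then have "?t \<circ> p \<in> carrier (aut_group G)" by (rule join_two_aut_restrict)
        (simp_all only: o_apply sw transpose_apply_first transpose_apply_second)
    moreover have "p = ?t \<circ> (?t \<circ> p)" by (simp add: fun_eq_iff)
    ultimately show ?thesis by (rule that(2))
  qed
qed

lemma join_two_generating_set:
  assumes S: "generating_set (aut_group G) S"
    and ev: "\<not> eigenvalue (laplacian_mat n G) (real n - 2)"
  shows "generating_set (aut_group (join_two n G)) (S \<union> {Transposition.transpose (n + 1) (n + 2)})"
proof -
  let ?A = "aut_group (join_two n G)" and ?H = "carrier (aut_group G)"
  let ?t = "Transposition.transpose (n + 1) (n + 2)"
  interpret A: group ?A by (rule aut_group_group)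
  have H: "aut_group G = ?A\<lparr>carrier := ?H\<rparr>" by (simp add: aut_group_def)
  have sub: "?H \<subseteq> carrier ?A" using join_two_aut_extend by blast
  have subg: "subgroup ?H ?A"
    by (rule A.group_incl_imp_subgroup[OF sub]) (use aut_group_group[of G] H in simp)
  have S': "S \<subseteq> ?H" "generate (aut_group G) S = ?H" using S by (auto simp: generating_set_def)
  have gen: "S \<union> {?t} \<subseteq> carrier ?A" using S' sub join_two_swap_aut by blast
  have "generate ?A S = ?H" using A.generate_consistent[OF S'(1) subg] S'(2) H by simp
  then have HS: "?H \<subseteq> generate ?A (S \<union> {?t})" using A.mono_generate[of S "S \<union> {?t}"] by blast
  have "carrier ?A \<subseteq> generate ?A (S \<union> {?t})"
  proof
    fix p assume "p \<in> carrier ?A"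
    then show "p \<in> generate ?A (S \<union> {?t})"
    proof (cases rule: join_two_aut_cases[OF _ ev, consumes 1])
      case (2 q)
      have "?t \<otimes>\<^bsub>?A\<^esub> q \<in> generate ?A (S \<union> {?t})"
        by (rule generate.eng[OF generate.incl]) (use 2 HS in auto)
      then show ?thesis by (simp add: 2 aut_group_mult)
    qed (use HS in blast)
  qed
  then show ?thesis using gen A.generate_incl[OF gen] by (auto simp: generating_set_def)
qed

end

theorem theoremV3:
  fixes n :: nat and G :: "nat pair_pre_digraph"
  assumes "strongly_uncontrollable n G"
  defines "L \<equiv> laplacian_mat n G"
    and "G' \<equiv> graph_join G (empty_graph {n + 1, n + 2})"
  shows "(strongly_uncontrollable (n + 2) G' \<longleftrightarrow>
            \<not> eigenvalue L (real n - 2) \<and> \<not> eigenvalue L (real n)) \<and>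
         (strongly_uncontrollable (n + 2) G' \<longrightarrow>
            (\<forall>S. generating_set (aut_group G) S \<longrightarrow>
                 generating_set (aut_group G') (S \<union> {Transposition.transpose (n + 1) (n + 2)})))"
proof -
  have G: "pair_graph G" and V: "pverts G = {1..n}"
    using assms(1) by (auto simp: strongly_uncontrollable_def)
  have G': "G' = join_two n G" by (simp add: G'_def join_two_def)
  show ?thesis
    unfolding G' L_def
    using join_two_strongly_uncontrollable_iff[OF assms(1)] join_two_generating_set[OF G V] by blast
qed

end
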